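(* Let $D\subseteq\mathbb{R}$ be an open interval, let $f:D\to\mathbb{R}$ be four times continuously differentiable, and let $x^*\in D$ be a simple zero of $f$. Let $\phi:\mathbb{R}\to\mathbb{R}$ be twice continuously differentiable with $$\phi(0)=0,\qquad \phi'(0)=-\tfrac12,\qquad |\phi''(0)|<\infty .$$ Consider the iteration, for $n=0,1,2,\dots$, $$y_n=x_n-\frac{f(x_n)}{f'(x_n)},\qquad z_n=x_n-\frac{f(x_n)^2}{\bigl(f(x_n)-f(y_n)\bigr)f'(x_n)},$$ $$x_{n+1}=z_n-\left[1-\frac{f(x_n)}{f(x_n)-f(y_n)}\left(1+\frac{f(y_n)}{f(x_n)-f(y_n)}\right)\right]\frac{f(x_n)}{f'(x_n)}\,\phi(t_n),\qquad t_n=\frac{f(y_n)}{f(x_n)}.$$ If the initial point $x_0$ is sufficiently close to $x^*$ (that is, there is $\delta>0$ such that this holds for every $x_0\in D$ with $|x_0-x^*|<\delta$), then the sequence $(x_n)$ converges to $x^*$ with order at least four.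
   Context: A simple zero of $f$ is a point $x^*$ with $f(x^* )=0$ and $f'(x^* )\neq 0$. A sequence $(x_n)$ generated by the method converges to $x^*$ with order at least $p$ (for $x_0$ sufficiently close to $x^*$) if there are $\delta>0$ and $C\ge 0$ such that for every $x_0\in D$ with $|x_0-x^*|<\delta$ all iterates are well defined and lie in $D$, $x_n\to x^*$, and $|x_{n+1}-x^*|\le C\,|x_n-x^*|^{p}$ for all $n$. Convention: if $f(x_n)=0$ the iteration stops, i.e. $x_{n+1}:=x_n$. *)

theory Defs
  imports "HOL-Analysis.Analysis"
begin

text \<open>
  Intended for open \<open>S\<close> only, so that \<^const>\<open>deriv\<close> at a point of \<open>S\<close> depends only on the
  values of \<open>f\<close> on \<open>S\<close>, and the values of the total function \<open>f\<close> outside \<open>S\<close> are irrelevant.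
\<close>

definition C_k_on :: "nat \<Rightarrow> (real \<Rightarrow> real) \<Rightarrow> real set \<Rightarrow> bool" where
  "C_k_on k f S \<longleftrightarrow>
     (\<forall>j<k. ((deriv ^^ j) f) differentiable_on S) \<and> continuous_on S ((deriv ^^ k) f)"

definition simple_zero :: "(real \<Rightarrow> real) \<Rightarrow> real \<Rightarrow> bool" where
  "simple_zero f a \<longleftrightarrow> f a = 0 \<and> deriv f a \<noteq> 0"

definition y_point :: "(real \<Rightarrow> real) \<Rightarrow> real \<Rightarrow> real" where
  "y_point f x = x - f x / deriv f x"

definition z_point :: "(real \<Rightarrow> real) \<Rightarrow> real \<Rightarrow> real" where
  "z_point f x = x - (f x)\<^sup>2 / ((f x - f (y_point f x)) * deriv f x)"

definition iter_step :: "(real \<Rightarrow> real) \<Rightarrow> (real \<Rightarrow> real) \<Rightarrow> real \<Rightarrow> real" where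
  "iter_step f \<phi> x =
     (if f x = 0 then x
      else let y = y_point f x; t = f y / f x in
        z_point f x
        - (1 - f x / (f x - f y) * (1 + f y / (f x - f y))) * (f x / deriv f x) * \<phi> t)"

text \<open>
  Division is total (\<open>a / 0 = 0\<close>) and \<open>f\<close> is only meaningful on \<open>D\<close>, so it has to be said
  separately when \<^const>\<open>iter_step\<close> is genuinely defined at \<open>x\<close>. The point \<open>z\<close> is not
  required to lie in \<open>D\<close> because \<open>f\<close> is never evaluated there.
\<close>

definition step_defined :: "real set \<Rightarrow> (real \<Rightarrow> real) \<Rightarrow> real \<Rightarrow> bool" where
  "step_defined D f x \<longleftrightarrow>
     x \<in> D \<and>
     (f x = 0 \<or> (deriv f x \<noteq> 0 \<and> y_point f x \<in> D \<and> f x \<noteq> f (y_point f x)))"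

definition converges_with_order_at_least ::
    "nat \<Rightarrow> real set \<Rightarrow> (real \<Rightarrow> bool) \<Rightarrow> (real \<Rightarrow> real) \<Rightarrow> real \<Rightarrow> bool" where
  "converges_with_order_at_least p D defd step a \<longleftrightarrow>
     (\<exists>\<delta>>0. \<exists>C\<ge>0. \<forall>x\<^sub>0\<in>D. \<bar>x\<^sub>0 - a\<bar> < \<delta> \<longrightarrow>
        (let x = (\<lambda>n. (step ^^ n) x\<^sub>0) in
           (\<forall>n. defd (x n) \<and> x n \<in> D) \<and>
           x \<longlonglongrightarrow> a \<and>
           (\<forall>n. \<bar>x (Suc n) - a\<bar> \<le> C * \<bar>x n - a\<bar> ^ p)))"

end

theory Submission
  imports Defs "HOL-Library.Landau_Symbols"
begin

text \<open>
  Write \<open>e = x - x\<^sup>*\<close>, \<open>u = f x / f' x\<close>, \<open>A = f'' x / (2 f' x)\<close>, \<open>B = f''' x / (6 f' x)\<close>.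
  One step of the method is \<open>x - u w(t)\<close>, where \<open>\<phi> t = - t/2 + O(t^2)\<close> forces
  \<open>w(t) = 1 + t + 2 t^2 + O(t^3)\<close>. Taylor expansion around \<open>x\<close> (rather than around \<open>x\<^sup>*\<close>),
  evaluated at \<open>x\<^sup>*\<close> and at \<open>y\<close>, gives \<open>e - u = A e^2 - B e^3 + O(e^4)\<close> and
  \<open>t = A u - B u^2 + O(e^3)\<close>. Hence \<open>u w(t) = u + A u^2 + (2 A^2 - B) u^3 + O(e^4) = e + O(e^4)\<close>.
  Near \<open>x\<^sup>*\<close> such an error bound contracts, which yields convergence of the iteration.
\<close>

section \<open>Derivatives and Taylor bounds of \<open>C_k_on\<close> functions\<close>

lemma C_k_on_isCont:
  assumes "C_k_on k f S" "open S" "x \<in> S" "j \<le> k"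
  shows "isCont ((deriv ^^ j) f) x"
proof -
  have "continuous_on S ((deriv ^^ j) f)"
    using assms(1,4) unfolding C_k_on_def
    by (cases "j = k") (auto intro: differentiable_imp_continuous_on)
  then show ?thesis
    using assms(2,3) by (simp add: continuous_on_eq_continuous_at)
qed

lemma C_k_on_DERIV:
  assumes "C_k_on k f S" "open S" "x \<in> S" "j < k"
  shows "((deriv ^^ j) f has_real_derivative (deriv ^^ Suc j) f x) (at x)"
proof -
  have "(deriv ^^ j) f differentiable at x"
    using assms unfolding C_k_on_def by (metis at_within_open differentiable_on_def)
  then have "(deriv ^^ j) f field_differentiable at x"
    by (simp add: field_differentiable_def real_differentiable_def)
  then show ?thesis
    by (simp add: field_differentiable_derivI)
qed

text \<open>A bound on the k-th derivative over the compact ball controls every Lagrange remainder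
  there. One \<open>M\<close> serves all pairs \<open>x\<close>, \<open>y\<close>; this uniformity
  permits expansion around a moving centre \<open>x\<close>, evaluated at the zero or at the Newton
  point.\<close>

lemma C_k_on_taylor_bound:
  assumes f: "C_k_on k f S" and "open S" and "a \<in> S" and "k > 0"
  obtains r M where "r > 0" "cball a r \<subseteq> S"
    "\<And>x y. x \<in> cball a r \<Longrightarrow> y \<in> cball a r \<Longrightarrow>
       \<bar>f y - (\<Sum>m<k. (deriv ^^ m) f x / fact m * (y - x) ^ m)\<bar> \<le> M * \<bar>y - x\<bar> ^ k"
proof -
  obtain r where r: "r > 0" "cball a r \<subseteq> S"
    using assms open_contains_cball by blast
  have "continuous_on (cball a r) ((deriv ^^ k) f)"
    using f r unfolding C_k_on_def by (meson continuous_on_subset)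
  then have "bounded ((deriv ^^ k) f ` cball a r)"
    by (intro compact_imp_bounded compact_continuous_image) auto
  then obtain M where M: "\<And>x. x \<in> cball a r \<Longrightarrow> \<bar>(deriv ^^ k) f x\<bar> \<le> M"
    by (auto simp: bounded_iff simp del: mem_cball)
  have "\<bar>f y - (\<Sum>m<k. (deriv ^^ m) f x / fact m * (y - x) ^ m)\<bar> \<le> M * \<bar>y - x\<bar> ^ k"
    if x: "x \<in> cball a r" and y: "y \<in> cball a r" for x y
  \<comment> \<open>\<open>Taylor\<close> requires distinct points. If they agree, only the term
    \<open>m = 0\<close> survives, as \<open>0 ^ 0 = 1\<close>, and \<open>k > 0\<close> makes the
    right-hand side 0.\<close>
  proof (cases "y = x")
    case True
    then show ?thesis
      using \<open>k > 0\<close> by (simp add: power_0_left if_distrib sum.delta cong: if_cong)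
  next
    case False
    have D: "\<forall>m t. m < k \<and> a - r \<le> t \<and> t \<le> a + r \<longrightarrow>
        DERIV ((deriv ^^ m) f) t :> (deriv ^^ Suc m) f t"
    proof (intro allI impI)
      fix m t assume "m < k \<and> a - r \<le> t \<and> t \<le> a + r"
      then have "t \<in> S" "m < k" using r by (auto simp: dist_real_def abs_le_iff subset_iff)
      then show "DERIV ((deriv ^^ m) f) t :> (deriv ^^ Suc m) f t"
        using C_k_on_DERIV f \<open>open S\<close> by blast
    qed
    obtain t where t: "if y < x then y < t \<and> t < x else x < t \<and> t < y"
      and eq: "f y = (\<Sum>m<k. (deriv ^^ m) f x / fact m * (y - x) ^ m)
                  + (deriv ^^ k) f t / fact k * (y - x) ^ k"
      using Taylor[of k "\<lambda>m. (deriv ^^ m) f" f "a - r" "a + r" x y] \<open>k > 0\<close> D x y False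
      by (auto simp: dist_real_def abs_le_iff)
    have "t \<in> cball a r"
      using t x y by (auto simp: dist_real_def abs_le_iff split: if_splits)
    then have "\<bar>(deriv ^^ k) f t\<bar> / fact k \<le> M / 1"
      using M by (intro frac_le) (auto intro: order_trans[OF abs_ge_zero])
    then have "\<bar>(deriv ^^ k) f t / fact k * (y - x) ^ k\<bar> \<le> M * \<bar>y - x\<bar> ^ k"
      unfolding abs_mult power_abs by (intro mult_right_mono) auto
    then show ?thesis using eq by simp
  qed
  then show ?thesis using that r by blast
qed

section \<open>Local convergence from a one-step error bound\<close>

lemma converges_with_order_at_leastI:
  assumes "p \<ge> 2" and D: "open D" "a \<in> D"
    and defd: "\<forall>\<^sub>F x in nhds a. defd x"
    and bound: "\<forall>\<^sub>F x in nhds a. \<bar>step x - a\<bar> \<le> C * \<bar>x - a\<bar> ^ p"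
  shows "converges_with_order_at_least p D defd step a"
proof -
  have "\<forall>\<^sub>F x in nhds a. defd x \<and> x \<in> D \<and> \<bar>step x - a\<bar> \<le> C * \<bar>x - a\<bar> ^ p"
    using defd bound eventually_nhds_in_open[OF D] by eventually_elim auto
  then obtain d where d: "d > 0"
    "\<And>x. \<bar>x - a\<bar> < d \<Longrightarrow> defd x \<and> x \<in> D \<and> \<bar>step x - a\<bar> \<le> C * \<bar>x - a\<bar> ^ p"
    unfolding eventually_nhds_metric dist_real_def by blast
  \<comment> \<open>\<open>C\<close> may be negative; \<open>K\<close> is a legitimate order
    constant, and \<open>K >= 1\<close> keeps \<open>1 / (2 * K)\<close> positive and below
    1.\<close>
  define K where "K = max C 1"
  have K: "K \<ge> 1" "C \<le> K" by (auto simp: K_def)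
  \<comment> \<open>Inside this radius \<open>K * |x - a| <= 1/2\<close>. Since also
    \<open>|x - a| <= 1\<close>, the exponent \<open>p\<close> can be lowered to 2; one factor
    \<open>|x - a|\<close> is then spent against \<open>K\<close>, and each step at least halves the
    distance.\<close>
  define \<delta> where "\<delta> = min d (1 / (2 * K))"
  have \<delta>: "\<delta> > 0" "\<delta> \<le> d" "\<delta> \<le> 1 / (2 * K)" using d K by (auto simp: \<delta>_def)
  have "\<delta> \<le> 1" using \<delta>(3) K by (smt (verit) divide_le_eq_1)
  have bound: "\<bar>step x - a\<bar> \<le> K * \<bar>x - a\<bar> ^ p" if "\<bar>x - a\<bar> < \<delta>" for x
  proof -
    have "\<bar>step x - a\<bar> \<le> C * \<bar>x - a\<bar> ^ p"
      using d(2)[of x] that \<delta>(2) by simp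
    also have "\<dots> \<le> K * \<bar>x - a\<bar> ^ p"
      using K(2) by (rule mult_right_mono) simp
    finally show ?thesis .
  qed
  have half: "\<bar>step x - a\<bar> \<le> \<bar>x - a\<bar> / 2" if x: "\<bar>x - a\<bar> < \<delta>" for x
  proof -
    have "K * \<bar>x - a\<bar> \<le> K * (1 / (2 * K))"
      using x \<delta>(3) K by (intro mult_left_mono) auto
    then have half: "K * \<bar>x - a\<bar> \<le> 1 / 2" using K by simp
    have "\<bar>x - a\<bar> ^ p \<le> \<bar>x - a\<bar> ^ 2"
      using x \<open>\<delta> \<le> 1\<close> \<open>p \<ge> 2\<close> by (intro power_decreasing) auto
    then have "K * \<bar>x - a\<bar> ^ p \<le> K * \<bar>x - a\<bar> * \<bar>x - a\<bar>"
      using K by (simp add: power2_eq_square mult.assoc)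
    also have "\<dots> \<le> 1 / 2 * \<bar>x - a\<bar>"
      using half by (intro mult_right_mono) auto
    finally show ?thesis using bound[OF x] by simp
  qed
  show ?thesis
    unfolding converges_with_order_at_least_def Let_def
  proof (intro exI conjI ballI impI)
    show "\<delta> > 0" "K \<ge> 0" using \<delta> K by auto
    fix x0 assume x0: "x0 \<in> D" "\<bar>x0 - a\<bar> < \<delta>"
    \<comment> \<open>The strict bound must be carried along: \<open>half\<close> applies only
      inside the radius, and at \<open>n = 0\<close> the geometric bound gives merely a non-strict
      one.\<close>
    have decay: "\<bar>(step ^^ n) x0 - a\<bar> < \<delta> \<and> \<bar>(step ^^ n) x0 - a\<bar> \<le> \<delta> * (1 / 2) ^ n" for n
    proof (induction n)
      case 0
      then show ?case using x0 by simp
    next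
      case (Suc n)
      then have step: "\<bar>(step ^^ Suc n) x0 - a\<bar> \<le> \<bar>(step ^^ n) x0 - a\<bar> / 2"
        using half by simp
      have "z / 2 < \<delta>" if "z < \<delta>" for z
        using that \<delta>(1) by linarith
      with Suc have "\<bar>(step ^^ n) x0 - a\<bar> / 2 < \<delta>" by blast
      with step have "\<bar>(step ^^ Suc n) x0 - a\<bar> < \<delta>" by (rule le_less_trans)
      moreover have "\<bar>(step ^^ Suc n) x0 - a\<bar> \<le> \<delta> * (1 / 2) ^ Suc n"
        using step Suc by simp
      ultimately show ?case ..
    qed
    show "\<forall>n. defd ((step ^^ n) x0) \<and> (step ^^ n) x0 \<in> D"
    proof
      fix n
      have "\<bar>(step ^^ n) x0 - a\<bar> < d" using decay[of n] \<delta>(2) by linarith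
      from d(2)[OF this] show "defd ((step ^^ n) x0) \<and> (step ^^ n) x0 \<in> D" by blast
    qed
    show "\<forall>n. \<bar>(step ^^ Suc n) x0 - a\<bar> \<le> K * \<bar>(step ^^ n) x0 - a\<bar> ^ p"
      using bound[OF decay[THEN conjunct1]] by simp
    have "(\<lambda>n. (1 / 2 :: real) ^ n) \<longlonglongrightarrow> 0"
      by (rule LIMSEQ_power_zero) simp
    from tendsto_mult_right_zero[OF this, of \<delta>]
    have "(\<lambda>n. (step ^^ n) x0 - a) \<longlonglongrightarrow> 0"
    proof (rule Lim_null_comparison[rotated])
      show "\<forall>\<^sub>F n in sequentially. norm ((step ^^ n) x0 - a) \<le> \<delta> * (1 / 2) ^ n"
        unfolding real_norm_def by (intro always_eventually allI decay[THEN conjunct2])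
    qed
    then show "(\<lambda>n. (step ^^ n) x0) \<longlonglongrightarrow> a"
      by (rule LIM_zero_cancel)
  qed
qed

section \<open>The step as a weighted Newton step\<close>

definition step_weight :: "(real \<Rightarrow> real) \<Rightarrow> real \<Rightarrow> real" where
  "step_weight \<phi> t = 1 / (1 - t) + (1 - 1 / (1 - t)\<^sup>2) * \<phi> t"

text \<open>Substituting \<open>f y = t * f x\<close> turns both \<open>f x / (f x - f y)\<close>
  and \<open>1 + f y / (f x - f y)\<close> into \<open>1 / (1 - t)\<close>. So \<open>z\<close>
  contributes the first summand of the weight and the bracket becomes
  \<open>1 - 1 / (1 - t)^2\<close>.\<close>

lemma iter_step_eq_step_weight:
  fixes f \<phi> x
  defines "t \<equiv> f (y_point f x) / f x"
  assumes "f x \<noteq> 0" "t \<noteq> 1"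
  shows "iter_step f \<phi> x = x - f x / deriv f x * step_weight \<phi> t"
proof -
  have [simp]: "f x - f (y_point f x) = f x * (1 - t)"
    using assms(2) by (simp add: t_def right_diff_distrib)
  have fy: "f (y_point f x) = f x * t"
    using assms(2) by (simp add: t_def)
  have "1 - t \<noteq> 0" using assms(3) by simp
  have "z_point f x = x - f x / deriv f x * (1 / (1 - t))"
    using assms(2) by (simp add: z_point_def power2_eq_square)
  moreover have "f x / (f x * (1 - t)) * (1 + f x * t / (f x * (1 - t))) = 1 / (1 - t)\<^sup>2"
    using assms(2) \<open>1 - t \<noteq> 0\<close> by (simp add: divide_simps power2_eq_square)
  ultimately show ?thesis
    unfolding iter_step_def Let_def t_def[symmetric] step_weight_def
    using assms(2) by (simp add: fy algebra_simps del: times_divide_eq_left times_divide_eq_right)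
qed

text \<open>The factor \<open>1 - 1 / (1 - t)^2 = t * (t - 2) / (1 - t)^2\<close> vanishes at 0, so
  the quadratic remainder of \<open>\<phi>\<close> enters only at order 3. The filter is the full
  \<open>nhds 0\<close> because the lemma is composed with a ratio that may itself be 0 at points
  near the zero of \<open>f\<close>.\<close>

lemma step_weight_expansion:
  assumes \<phi>: "C_k_on 2 \<phi> UNIV" and "\<phi> 0 = 0" "deriv \<phi> 0 = - 1 / 2"
  shows "(\<lambda>t. step_weight \<phi> t - (1 + t + 2 * t\<^sup>2)) \<in> O[nhds 0](\<lambda>t. t ^ 3)"
proof -
  obtain r M where r: "r > 0" and
    M: "\<And>x y. x \<in> cball 0 r \<Longrightarrow> y \<in> cball 0 r \<Longrightarrow>
       \<bar>\<phi> y - (\<Sum>m<2. (deriv ^^ m) \<phi> x / fact m * (y - x) ^ m)\<bar> \<le> M * \<bar>y - x\<bar> ^ 2"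
    using C_k_on_taylor_bound[OF \<phi>, of 0] by auto
  have \<psi>: "(\<lambda>t. \<phi> t + t / 2) \<in> O[nhds 0](\<lambda>t. t ^ 2)"
  proof (rule bigoI)
    have "\<forall>\<^sub>F t in nhds 0. t \<in> ball 0 r"
      using r by (intro eventually_nhds_in_open) auto
    then show "\<forall>\<^sub>F t in nhds 0. norm (\<phi> t + t / 2) \<le> M * norm (t ^ 2)"
    proof eventually_elim
      case (elim t)
      then show ?case
        using M[of 0 t] r assms(2,3) by (simp add: numeral_2_eq_2 algebra_simps)
    qed
  qed
  have lim: "((\<lambda>t. t) \<longlongrightarrow> 0) (nhds (0::real))" by (rule filterlim_ident)
  have near: "\<forall>\<^sub>F t in nhds (0::real). t \<noteq> 1"
    using tendsto_imp_eventually_ne[OF lim, of 1] by simp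
  \<comment> \<open>Cubic remainder for \<open>\<phi> t = - t / 2\<close>: use
    \<open>1 / (1 - t) = 1 + t + t^2 + t^3 / (1 - t)\<close> and
    \<open>(1 - t / 2) / (1 - t)^2 = 1 + t * (3 / 2 - t) / (1 - t)^2\<close>, the latter multiplied
    by \<open>t^2\<close>.\<close>
  have bdd1: "(\<lambda>t::real. 1 / (1 - t) + (3 / 2 - t) / (1 - t)\<^sup>2) \<in> O[nhds 0](\<lambda>_. 1)"
    by (rule bigoI_tendsto[of _ _ "1 / (1 - 0) + (3 / 2 - 0) / (1 - 0)\<^sup>2"])
      (auto intro!: tendsto_eq_intros lim)
  have bdd2: "(\<lambda>t::real. (t - 2) / (1 - t)\<^sup>2) \<in> O[nhds 0](\<lambda>_. 1)"
    by (rule bigoI_tendsto[of _ _ "(0 - 2) / (1 - 0)\<^sup>2"])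
      (auto intro!: tendsto_eq_intros lim)
  have "(\<lambda>t. t ^ 3 * (1 / (1 - t) + (3 / 2 - t) / (1 - t)\<^sup>2)
           + t * ((t - 2) / (1 - t)\<^sup>2) * (\<phi> t + t / 2)) \<in> O[nhds 0](\<lambda>t. t ^ 3)"
  proof (rule sum_in_bigo)
    show "(\<lambda>t. t ^ 3 * (1 / (1 - t) + (3 / 2 - t) / (1 - t)\<^sup>2)) \<in> O[nhds 0](\<lambda>t::real. t ^ 3)"
      using landau_o.big.mult[OF landau_o.big_refl bdd1, of "\<lambda>t. t ^ 3"] by simp
    show "(\<lambda>t. t * ((t - 2) / (1 - t)\<^sup>2) * (\<phi> t + t / 2)) \<in> O[nhds 0](\<lambda>t. t ^ 3)"
      using landau_o.big.mult[OF landau_o.big.mult[OF landau_o.big_refl bdd2, of "\<lambda>t. t"] \<psi>]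
      by (simp add: power2_eq_square power3_eq_cube mult.assoc)
  qed
  moreover have "\<forall>\<^sub>F t in nhds 0. step_weight \<phi> t - (1 + t + 2 * t\<^sup>2) =
       t ^ 3 * (1 / (1 - t) + (3 / 2 - t) / (1 - t)\<^sup>2)
           + t * ((t - 2) / (1 - t)\<^sup>2) * (\<phi> t + t / 2)"
    using near
  proof eventually_elim
    case (elim t)
    then have "1 - t \<noteq> 0" by simp
    then show ?case
      unfolding step_weight_def
      by (simp add: divide_simps) (simp add: algebra_simps power2_eq_square power3_eq_cube)
  qed
  ultimately show ?thesis
    by (simp add: landau_o.big.in_cong)
qed

section \<open>Fourth order of the iteration\<close>

theorem theorem1:
  fixes D :: "real set" and f \<phi> :: "real \<Rightarrow> real" and xstar :: real
  assumes "open D" and "is_interval D"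
    and "C_k_on 4 f D"
    and "xstar \<in> D" and "simple_zero f xstar"
    and "C_k_on 2 \<phi> UNIV"
    and "\<phi> 0 = 0" and "deriv \<phi> 0 = - 1 / 2"
  shows "converges_with_order_at_least 4 D (step_defined D f) (iter_step f \<phi>) xstar"
proof -
  have fa: "f xstar = 0" "deriv f xstar \<noteq> 0"
    using assms(5) by (auto simp: simple_zero_def)
  define e where "e = (\<lambda>x. x - xstar)"
  define u where "u = (\<lambda>x. f x / deriv f x)"
  define A where "A = (\<lambda>x. (deriv ^^ 2) f x / (2 * deriv f x))"
  define B where "B = (\<lambda>x. (deriv ^^ 3) f x / (6 * deriv f x))"
  define t where "t = (\<lambda>x. f (y_point f x) / f x)"
  \<comment> \<open>The punctured filter excludes \<open>xstar\<close>, where \<open>t\<close> would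
    divide by \<open>f xstar = 0\<close>.\<close>
  define ordr where "ordr = (\<lambda>g n. g \<in> O[at xstar](\<lambda>x. e x ^ n))"

  have e_lim: "(e \<longlongrightarrow> 0) (at xstar)"
    unfolding e_def by (auto intro!: tendsto_eq_intros)
  have ordr_mono: "ordr g m" if "ordr g n" "m \<le> n" for g m n
  proof -
    have "\<forall>\<^sub>F x in at xstar. norm (e x) < 1"
      using tendstoD[OF e_lim, of 1] by simp
    then have "\<forall>\<^sub>F x in at xstar. norm (e x ^ n) \<le> 1 * norm (e x ^ m)"
      by eventually_elim (use \<open>m \<le> n\<close> in \<open>simp add: power_abs power_decreasing\<close>)
    then have "(\<lambda>x. e x ^ n) \<in> O[at xstar](\<lambda>x. e x ^ m)"
      by (rule bigoI)
    then show ?thesis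
      using that(1) unfolding ordr_def by (rule landau_o.big_trans[rotated])
  qed
  have ordr_mult: "ordr (\<lambda>x. g x * h x) (m + n)" if "ordr g m" "ordr h n" for g h m n
    using landau_o.big.mult[OF that[unfolded ordr_def]] unfolding ordr_def
    by (simp add: power_add)
  have ordr_mult0: "ordr (\<lambda>x. g x * h x) n" if "ordr g 0" "ordr h n" for g h n
    using ordr_mult[OF that] by simp
  have ordr_add: "ordr (\<lambda>x. g x + h x) n" if "ordr g n" "ordr h n" for g h n
    using that unfolding ordr_def by (rule sum_in_bigo)
  have ordr_diff: "ordr (\<lambda>x. g x - h x) n" if "ordr g n" "ordr h n" for g h n
    using that unfolding ordr_def by (rule sum_in_bigo)
  have ordr_const: "ordr (\<lambda>x. c * g x) n" if "ordr g n" for c g n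
    using that unfolding ordr_def by (cases "c = 0") auto
  have ordr_lim: "ordr g 0" if "(g \<longlongrightarrow> l) (at xstar)" for g l
    using that unfolding ordr_def by (intro bigoI_tendsto[of _ _ l]) auto
  have ordr_cong: "ordr h n"
    if "ordr g n" "\<forall>\<^sub>F x in at xstar. g x = h x" for g h n
    using that unfolding ordr_def by (simp add: landau_o.big.in_cong)
  have e_ord: "ordr (\<lambda>x. e x ^ n) n" for n
    unfolding ordr_def by simp

  \<comment> \<open>Limits at the zero and nonvanishing nearby\<close>
  have cont: "((deriv ^^ j) f \<longlongrightarrow> (deriv ^^ j) f xstar) (at xstar)" if "j \<le> 4" for j
    using C_k_on_isCont[OF assms(3,1,4) that] by (simp add: isCont_def)
  have f_lim: "(f \<longlongrightarrow> 0) (at xstar)" using cont[of 0] fa by simp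
  have f'_lim: "(deriv f \<longlongrightarrow> deriv f xstar) (at xstar)" using cont[of 1] by simp
  have u_lim: "(u \<longlongrightarrow> 0) (at xstar)"
    unfolding u_def using fa by (auto intro!: tendsto_eq_intros f_lim f'_lim)
  have y_lim: "(y_point f \<longlongrightarrow> xstar) (at xstar)"
    unfolding y_point_def u_def[THEN fun_cong, symmetric] using u_lim
    by (auto intro!: tendsto_eq_intros)
  have A_ord: "ordr A 0"
    unfolding A_def using fa
    by (intro ordr_lim[OF tendsto_divide[OF cont[of 2] tendsto_mult[OF tendsto_const f'_lim]]]) auto
  have B_ord: "ordr B 0"
    unfolding B_def using fa
    by (intro ordr_lim[OF tendsto_divide[OF cont[of 3] tendsto_mult[OF tendsto_const f'_lim]]]) auto
  have inv_ord: "ordr (\<lambda>x. 1 / deriv f x) 0"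
    using fa by (intro ordr_lim[OF tendsto_divide[OF tendsto_const f'_lim]]) auto

  have f'_nz: "\<forall>\<^sub>F x in at xstar. deriv f x \<noteq> 0"
    using f'_lim fa by (intro tendsto_imp_eventually_ne)
  have f_nz: "\<forall>\<^sub>F x in at xstar. f x \<noteq> 0"
  proof -
    \<comment> \<open>A simple zero is isolated: the difference quotient has a nonzero limit, so its
      numerator \<open>f x\<close> is eventually nonzero.\<close>
    have "((\<lambda>x. (f x - f xstar) / (x - xstar)) \<longlongrightarrow> deriv f xstar) (at xstar)"
      using C_k_on_DERIV[OF assms(3,1,4), of 0] by (simp add: has_field_derivative_iff)
    from tendsto_imp_eventually_ne[OF this fa(2)] show ?thesis
      by eventually_elim (auto simp: fa)
  qed

  \<comment> \<open>Taylor expansions of \<open>e - u\<close> and of \<open>t\<close>\<close>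
  obtain r M where r: "r > 0" "cball xstar r \<subseteq> D" and
    M: "\<And>x y. x \<in> cball xstar r \<Longrightarrow> y \<in> cball xstar r \<Longrightarrow>
       \<bar>f y - (\<Sum>m<4. (deriv ^^ m) f x / fact m * (y - x) ^ m)\<bar> \<le> M * \<bar>y - x\<bar> ^ 4"
    using C_k_on_taylor_bound[OF assms(3,1,4)] by auto
  have sum4: "(\<Sum>m<4. (deriv ^^ m) f x / fact m * h ^ m) =
      f x + deriv f x * h + (deriv ^^ 2) f x / 2 * h ^ 2 + (deriv ^^ 3) f x / 6 * h ^ 3" for x h
    by (simp add: eval_nat_numeral)
  have x_near: "\<forall>\<^sub>F x in at xstar. x \<in> cball xstar r"
    using tendstoD[OF tendsto_ident_at r(1)]
    by (rule eventually_mono) (simp add: dist_commute)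
  have y_near: "\<forall>\<^sub>F x in at xstar. y_point f x \<in> cball xstar r"
    using tendstoD[OF y_lim r(1)] by (auto simp: dist_commute elim!: eventually_mono)

  have E1: "ordr (\<lambda>x. e x - u x - A x * e x ^ 2 + B x * e x ^ 3) 4"
  proof -
    \<comment> \<open>\<open>R x\<close> is the negated Taylor polynomial around \<open>x\<close> at
      \<open>xstar\<close>; as \<open>f xstar = 0\<close>, it is the remainder itself. Division by
      \<open>deriv f x\<close> gives the claim.\<close>
    define R where "R = (\<lambda>x. deriv f x * e x - f x - (deriv ^^ 2) f x / 2 * e x ^ 2
        + (deriv ^^ 3) f x / 6 * e x ^ 3)"
    have "ordr R 4"
      unfolding ordr_def
    proof (rule bigoI)
      show "\<forall>\<^sub>F x in at xstar. norm (R x) \<le> M * norm (e x ^ 4)"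
        using x_near
      proof eventually_elim
        case (elim x)
        have h: "xstar - x = - e x" by (simp add: e_def)
        show ?case
          using M[OF elim, of xstar] r(1) unfolding sum4 h R_def
          by (simp add: fa algebra_simps power_abs)
      qed
    qed
    from ordr_mult0[OF inv_ord this] have "ordr (\<lambda>x. 1 / deriv f x * R x) 4" by simp
    then show ?thesis
    proof (rule ordr_cong)
      show "\<forall>\<^sub>F x in at xstar. 1 / deriv f x * R x = e x - u x - A x * e x ^ 2 + B x * e x ^ 3"
        using f'_nz by eventually_elim (simp add: R_def u_def A_def B_def field_simps)
    qed
  qed
  \<comment> \<open>\<open>E2\<close> and \<open>E3\<close> are coarser truncations of
    \<open>E1\<close>, for use where the cofactor already has positive order. \<open>E3\<close> also
    yields that \<open>u\<close> is of order 1.\<close>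
  have E2: "ordr (\<lambda>x. e x - u x - A x * e x ^ 2) 3"
    using ordr_diff[OF ordr_mono[OF E1, of 3] ordr_mult0[OF B_ord e_ord[of 3]]] by simp
  have E3: "ordr (\<lambda>x. e x - u x) 2"
    using ordr_add[OF ordr_mono[OF E2, of 2] ordr_mult0[OF A_ord e_ord[of 2]]] by simp
  have e1: "ordr e 1" using e_ord[of 1] by simp
  have u1: "ordr u 1"
    using ordr_diff[OF e1 ordr_mono[OF E3, of 1]] by simp
  have upow: "ordr (\<lambda>x. u x ^ n) n" for n
    using landau_o.big_power[of u _ _ n] u1 unfolding ordr_def by simp

  have T1: "ordr (\<lambda>x. t x - A x * u x + B x * u x ^ 2) 3"
  proof -
    \<comment> \<open>The Newton step cancels the constant and linear terms:
      \<open>f x + deriv f x * (- u x) = 0\<close>. Hence \<open>R x\<close> is the Taylor remainder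
      at \<open>y\<close>, bounded by a multiple of \<open>u^4\<close>; dividing by
      \<open>f x = deriv f x * u x\<close> costs one power of \<open>u\<close>.\<close>
    define R where "R = (\<lambda>x. f (y_point f x) - (deriv ^^ 2) f x / 2 * u x ^ 2
        + (deriv ^^ 3) f x / 6 * u x ^ 3)"
    have "(\<lambda>x. R x / u x) \<in> O[at xstar](\<lambda>x. u x ^ 3)"
    proof (rule bigoI)
      show "\<forall>\<^sub>F x in at xstar. norm (R x / u x) \<le> M * norm (u x ^ 3)"
        using x_near y_near f_nz f'_nz
      proof eventually_elim
        case (elim x)
        have h: "y_point f x - x = - u x" by (simp add: y_point_def u_def)
        have "deriv f x * u x = f x" "u x \<noteq> 0" using elim by (simp_all add: u_def)
        then have "\<bar>R x\<bar> \<le> M * \<bar>u x\<bar> ^ 4"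
          using M[OF elim(1,2)] unfolding sum4 h R_def by simp
        then have "\<bar>R x\<bar> / \<bar>u x\<bar> \<le> M * \<bar>u x\<bar> ^ 4 / \<bar>u x\<bar>"
          by (rule divide_right_mono) simp
        also have "M * \<bar>u x\<bar> ^ 4 / \<bar>u x\<bar> = M * \<bar>u x\<bar> ^ 3"
          using \<open>u x \<noteq> 0\<close> power_diff[of "\<bar>u x\<bar>" 1 4] by simp
        finally show ?case by (simp add: power_abs)
      qed
    qed
    then have "ordr (\<lambda>x. R x / u x) 3"
      using upow[of 3] unfolding ordr_def by (rule landau_o.big_trans)
    from ordr_mult0[OF inv_ord this] have "ordr (\<lambda>x. 1 / deriv f x * (R x / u x)) 3" by simp
    then show ?thesis
    proof (rule ordr_cong)
      show "\<forall>\<^sub>F x in at xstar.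
          1 / deriv f x * (R x / u x) = t x - A x * u x + B x * u x ^ 2"
        using f_nz f'_nz
      proof eventually_elim
        case (elim x)
        have fx: "f x = deriv f x * u x" and "u x \<noteq> 0" using elim by (simp_all add: u_def)
        have "t x = f (y_point f x) / (deriv f x * u x)"
          unfolding t_def using arg_cong[OF fx, of "(/) (f (y_point f x))"] .
        moreover have "R x / u x = f (y_point f x) / u x - (deriv ^^ 2) f x / 2 * u x
            + (deriv ^^ 3) f x / 6 * u x ^ 2"
          using \<open>u x \<noteq> 0\<close> unfolding R_def
          by (simp add: add_divide_distrib diff_divide_distrib power2_eq_square power3_eq_cube)
        ultimately show ?case
          unfolding A_def B_def by (simp add: ring_distribs)
      qed
    qed
  qed
  have T2: "ordr (\<lambda>x. t x - A x * u x) 2"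
    using ordr_diff[OF ordr_mono[OF T1, of 2] ordr_mult0[OF B_ord upow[of 2]]] by simp
  have T3: "ordr t 1"
    using ordr_add[OF ordr_mono[OF T2, of 1] ordr_mult0[OF A_ord u1]] by simp
  have t_lim: "(t \<longlongrightarrow> 0) (at xstar)"
  proof -
    have "t \<in> O[at xstar](e)" using T3 by (simp add: ordr_def)
    then obtain c where "\<forall>\<^sub>F x in at xstar. norm (t x) \<le> c * norm (e x)"
      by (elim landau_o.bigE)
    moreover have "((\<lambda>x. c * norm (e x)) \<longlongrightarrow> 0) (at xstar)"
      using e_lim by (auto intro!: tendsto_eq_intros)
    ultimately show ?thesis by (rule Lim_null_comparison)
  qed
  have W: "ordr (\<lambda>x. step_weight \<phi> (t x) - (1 + t x + 2 * t x ^ 2)) 3"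
  proof -
    have "(\<lambda>x. step_weight \<phi> (t x) - (1 + t x + 2 * t x ^ 2)) \<in> O[at xstar](\<lambda>x. t x ^ 3)"
      using landau_o.big.compose[OF step_weight_expansion[OF assms(6-8)] t_lim] by simp
    moreover have "ordr (\<lambda>x. t x ^ 3) 3"
      using landau_o.big_power[of t _ _ 3] T3 unfolding ordr_def by simp
    ultimately show ?thesis
      unfolding ordr_def by (rule landau_o.big_trans)
  qed

  \<comment> \<open>Cancellation up to fourth order\<close>
  have err: "ordr (\<lambda>x. e x - u x * step_weight \<phi> (t x)) 4"
  proof -
    have eu: "ordr (\<lambda>x. e x + u x) 1" using ordr_add[OF e1 u1] .
    have e_u: "ordr (\<lambda>x. e x * u x) 2" using ordr_mult[OF e1 u1] by (simp add: numeral_2_eq_2)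
    \<comment> \<open>These are the cofactors in \<open>e^3 + e^2 * u - 2 * u^3 = (e - u) * (e^2 + 2
      * e * u + 2 * u^2)\<close> and
      \<open>e^3 - u^3 = (e - u) * (e^2 + e * u + u^2)\<close>.\<close>
    have q1: "ordr (\<lambda>x. e x ^ 2 + 2 * (e x * u x) + 2 * u x ^ 2) 2"
      by (intro ordr_add ordr_const e_ord e_u upow)
    have q2: "ordr (\<lambda>x. e x ^ 2 + e x * u x + u x ^ 2) 2"
      by (intro ordr_add e_ord e_u upow)
    have tAu: "ordr (\<lambda>x. t x + A x * u x) 1"
      using ordr_add[OF T3 ordr_mult0[OF A_ord u1]] .
    \<comment> \<open>Each term trades one expression for another: \<open>s1\<close> expands
      \<open>u * t\<close>; \<open>s2\<close> turns \<open>A * e^2\<close> into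
      \<open>A * u^2\<close>, leaving \<open>A^2 * e^2 * (e + u)\<close>, which \<open>s3\<close>
      turns into \<open>2 * A^2 * u^3\<close>; \<open>s4\<close> turns \<open>B * e^3\<close> into
      \<open>B * u^3\<close>; \<open>s5\<close> turns \<open>2 * u * t^2\<close> into
      \<open>2 * A^2 * u^3\<close>; \<open>s6\<close> replaces the weight by its quadratic
      polynomial.\<close>
    have s1: "ordr (\<lambda>x. u x * (t x - A x * u x + B x * u x ^ 2)) 4"
      using ordr_mult[OF u1 T1] by simp
    have s2: "ordr (\<lambda>x. A x * ((e x - u x - A x * e x ^ 2) * (e x + u x))) 4"
      using ordr_mult0[OF A_ord ordr_mult[OF E2 eu]] by simp
    have s3: "ordr (\<lambda>x. A x * (A x * ((e x - u x) *
        (e x ^ 2 + 2 * (e x * u x) + 2 * u x ^ 2)))) 4"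
      using ordr_mult0[OF A_ord ordr_mult0[OF A_ord ordr_mult[OF E3 q1]]] by simp
    have s4: "ordr (\<lambda>x. B x * ((e x - u x) * (e x ^ 2 + e x * u x + u x ^ 2))) 4"
      using ordr_mult0[OF B_ord ordr_mult[OF E3 q2]] by simp
    have s5: "ordr (\<lambda>x. 2 * (u x * ((t x - A x * u x) * (t x + A x * u x)))) 4"
      using ordr_const[OF ordr_mult[OF u1 ordr_mult[OF T2 tAu]]] by simp
    have s6: "ordr (\<lambda>x. u x * (step_weight \<phi> (t x) - (1 + t x + 2 * t x ^ 2))) 4"
      using ordr_mult[OF u1 W] by simp
    \<comment> \<open>The error is exactly the signed sum of the terms \<open>E1\<close>, \<open>s1\<close>, ..., \<open>s6\<close>.\<close>
    show ?thesis
      by (rule ordr_cong[OF ordr_diff[OF ordr_diff[OF ordr_diff[OF ordr_add[OF ordr_add[OF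
            ordr_diff[OF E1 s1] s2] s3] s4] s5] s6]])
        (intro always_eventually allI, simp add: algebra_simps power2_eq_square power3_eq_cube)
  qed
  then obtain C where "\<forall>\<^sub>F x in at xstar. norm (e x - u x * step_weight \<phi> (t x)) \<le> C * norm (e x ^ 4)"
    unfolding ordr_def by (elim landau_o.bigE)
  moreover have t_ne: "\<forall>\<^sub>F x in at xstar. t x \<noteq> 1"
    using t_lim by (rule tendsto_imp_eventually_ne) simp
  ultimately have bound: "\<forall>\<^sub>F x in at xstar. \<bar>iter_step f \<phi> x - xstar\<bar> \<le> C * \<bar>x - xstar\<bar> ^ 4"
    using f_nz
  proof eventually_elim
    case (elim x)
    then show ?case
      using iter_step_eq_step_weight[of f x \<phi>]
      by (simp add: e_def u_def t_def power_abs algebra_simps)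
  qed
  have defd: "\<forall>\<^sub>F x in at xstar. step_defined D f x"
    using t_ne f_nz f'_nz x_near y_near
    by eventually_elim (use r in \<open>auto simp: step_defined_def t_def\<close>)
  \<comment> \<open>The bounds pass from the punctured to the full neighbourhood because at
    \<open>xstar\<close> the stopping rule applies: the step is defined there and has error
    0.\<close>
  show ?thesis
  proof (rule converges_with_order_at_leastI)
    show "\<forall>\<^sub>F x in nhds xstar. step_defined D f x"
      using defd fa assms(4) by (auto simp: eventually_nhds_conv_at step_defined_def)
    show "\<forall>\<^sub>F x in nhds xstar. \<bar>iter_step f \<phi> x - xstar\<bar> \<le> C * \<bar>x - xstar\<bar> ^ 4"
      using bound fa by (auto simp: eventually_nhds_conv_at iter_step_def)
  qed (use assms in auto)
qed

end
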